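(* Let $(X,p)$ be a partial metric space, let $r>0$, and let $\{x_n\}$ be a sequence in $X$ converging to $x\in X$. Then $\{y\in\overline{B^{p}_{r}}(x): p(x,x)=p(y,y)\}\subseteq R\text{-}LIM^{r}x_n$.
   Context: A partial metric on a nonempty set $X$ is a function $p:X\times X\to[0,\infty)$ such that for all $x,y,z\in X$: (p1) $0\le p(x,x)\le p(x,y)$; (p2) $x=y \iff p(x,x)=p(x,y)=p(y,y)$; (p3) $p(x,y)=p(y,x)$; (p4) $p(x,y)\le p(x,z)+p(z,y)-p(z,z)$. The pair $(X,p)$ is a partial metric space. A sequence $\{x_n\}$ in $X$ converges to $x\in X$ if for every $\epsilon>0$ there is $k\in\mathbb{N}$ such that $|p(x_n,x)-p(x,x)|<\epsilon$ for all $n\ge k$. For $r>0$ and $x\in X$, the closed ball is $\overline{B^{p}_{r}}(x)=\{y\in X: p(x,y)\le p(x,x)+r\}$. A sequence $\{x_n\}$ is $r$-convergent to $x$ from right if for every $\epsilon>0$ there is $k\in\mathbb{N}$ such that $|p(x_n,x)-p(x,x)|<r+\epsilon$ for all $n\ge k$ with $p(x_n,x)\ge p(x,x)$. $R\text{-}LIM^{r}x_n$ denotes the set of all $x\in X$ such that $\{x_n\}$ is $r$-convergent to $x$ from right. *)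

theory Defs
  imports Complex_Main
begin

text \<open>The values of p outside X are unconstrained.  On X, p takes values in the nonnegative reals
  by the first axiom.\<close>

locale partial_metric_space =
  fixes X :: "'a set" and p :: "'a \<Rightarrow> 'a \<Rightarrow> real"
  assumes nonempty: "X \<noteq> {}"
    and p1: "\<lbrakk>x \<in> X; y \<in> X\<rbrakk> \<Longrightarrow> 0 \<le> p x x \<and> p x x \<le> p x y"
    and p2: "\<lbrakk>x \<in> X; y \<in> X\<rbrakk> \<Longrightarrow> x = y \<longleftrightarrow> p x x = p x y \<and> p x y = p y y"
    and p3: "\<lbrakk>x \<in> X; y \<in> X\<rbrakk> \<Longrightarrow> p x y = p y x"
    and p4: "\<lbrakk>x \<in> X; y \<in> X; z \<in> X\<rbrakk> \<Longrightarrow> p x y \<le> p x z + p z y - p z z"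

definition pm_converges :: "('a \<Rightarrow> 'a \<Rightarrow> real) \<Rightarrow> (nat \<Rightarrow> 'a) \<Rightarrow> 'a \<Rightarrow> bool" where
  "pm_converges p s x \<longleftrightarrow> (\<forall>\<epsilon>>0. \<exists>k. \<forall>n\<ge>k. \<bar>p (s n) x - p x x\<bar> < \<epsilon>)"

definition pm_cball :: "'a set \<Rightarrow> ('a \<Rightarrow> 'a \<Rightarrow> real) \<Rightarrow> real \<Rightarrow> 'a \<Rightarrow> 'a set" where
  "pm_cball X p r x = {y \<in> X. p x y \<le> p x x + r}"

definition r_converges_right :: "('a \<Rightarrow> 'a \<Rightarrow> real) \<Rightarrow> real \<Rightarrow> (nat \<Rightarrow> 'a) \<Rightarrow> 'a \<Rightarrow> bool" where
  "r_converges_right p r s x \<longleftrightarrow>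
     (\<forall>\<epsilon>>0. \<exists>k. \<forall>n\<ge>k. p (s n) x \<ge> p x x \<longrightarrow> \<bar>p (s n) x - p x x\<bar> < r + \<epsilon>)"

definition R_LIM :: "'a set \<Rightarrow> ('a \<Rightarrow> 'a \<Rightarrow> real) \<Rightarrow> real \<Rightarrow> (nat \<Rightarrow> 'a) \<Rightarrow> 'a set" where
  "R_LIM X p r s = {x \<in> X. r_converges_right p r s x}"

end

theory Submission
  imports Defs
begin

text \<open>The triangle inequality \<open>p4\<close> through the limit \<open>x\<close>, with
  \<open>p x x = p y y\<close>, bounds \<open>p (s n) y - p y y\<close> by
  \<open>(p (s n) x - p x x) + (p x y - p x x)\<close>. Convergence makes the first bracket less
  than \<epsilon> eventually, and membership in the ball makes the second at most
  \<open>r\<close>.\<close>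

theorem theorem3p4:
  fixes X :: "'a set" and p :: "'a \<Rightarrow> 'a \<Rightarrow> real" and r :: real
    and s :: "nat \<Rightarrow> 'a" and x :: 'a
  assumes "partial_metric_space X p"
    and "r > 0"
    and "\<And>n. s n \<in> X"
    and "x \<in> X"
    and "pm_converges p s x"
  shows "{y \<in> pm_cball X p r x. p x x = p y y} \<subseteq> R_LIM X p r s"
proof
  fix y assume "y \<in> {y \<in> pm_cball X p r x. p x x = p y y}"
  then have y: "y \<in> X" "p x y \<le> p x x + r" "p x x = p y y"
    by (auto simp: pm_cball_def)
  have "\<exists>k. \<forall>n\<ge>k. p (s n) y \<ge> p y y \<longrightarrow> \<bar>p (s n) y - p y y\<bar> < r + \<epsilon>" if "\<epsilon> > 0" for \<epsilon>
  proof -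
    obtain k where k: "\<bar>p (s n) x - p x x\<bar> < \<epsilon>" if "n \<ge> k" for n
      using assms(5) \<open>\<epsilon> > 0\<close> unfolding pm_converges_def by blast
    \<comment> \<open>The guard \<open>p (s n) y \<ge> p y y\<close> makes the absolute value the
      difference itself, so the one-sided bound from \<open>p4\<close> with middle point
      \<open>x\<close> suffices.\<close>
    have "\<bar>p (s n) y - p y y\<bar> < r + \<epsilon>" if "n \<ge> k" "p (s n) y \<ge> p y y" for n
      using k[OF that(1)] that(2) y(2,3)
        partial_metric_space.p4[OF assms(1) assms(3)[of n] y(1) assms(4)]
      by linarith
    then show ?thesis by blast
  qed
  with y(1) show "y \<in> R_LIM X p r s"
    by (simp add: R_LIM_def r_converges_right_def)
qed

end
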